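(* Let $X$ be a log-concave random variable on $\mathbb{Z}$ and let $M(X)=\max_{n\in\mathbb{Z}}\mathbb{P}(X=n)$. Then $$M^2(X)\operatorname{Var}(X)+M(X)\le 1 \qquad (\mathrm{a})$$ and $$M^4(X)\,\mathbb{E}\,|X-\mathbb{E}[X]|^4+M(X)\big(M^2(X)-10M(X)+18\big)\le 9. \qquad (\mathrm{b})$$ The equality cases of (a) and (b) are identical: equality holds in (a) if and only if $X$ is, up to translation and reflection, a geometric random variable, and equality holds in (b) if and only if $X$ is, up to translation and reflection, a geometric random variable.
   Context: A function $f:\mathbb{R}\to[0,\infty)$ is log-concave if $f((1-s)x+sy)\ge f(x)^{1-s}f(y)^s$ for all $x,y\in\mathbb{R}$, $s\in[0,1]$. An integer-valued random variable $X$ is log-concave on $\mathbb{Z}$ if its probability mass function is the restriction to $\mathbb{Z}$ of a log-concave function. $M^k(X)$ means $(M(X))^k$. A geometric random variable has probability mass function $k\mapsto (1-q)q^k$ on $\{0,1,2,\dots\}$ for some $q\in[0,1)$, the degenerate case $q=0$ (with $0^0=1$) being the point mass at $0$. "Up to translation and reflection" means that $X$ has the law of $m+G$ or $m-G$ for some integer $m$ and some geometric random variable $G$. *)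

theory Defs
  imports "HOL-Probability.Probability"
begin

(* Isabelle sets 0 powr 0 = 0. An exponent vanishes only for s = 0 or s = 1, where
   the inequality holds trivially under either convention for 0^0. *)
definition log_concave_fun :: "(real \<Rightarrow> real) \<Rightarrow> bool" where
  "log_concave_fun f \<longleftrightarrow>
     (\<forall>x. 0 \<le> f x) \<and>
     (\<forall>x y. \<forall>s\<in>{0..1}. f x powr (1 - s) * f y powr s \<le> f ((1 - s) * x + s * y))"

definition log_concave_rv :: "'a measure \<Rightarrow> ('a \<Rightarrow> int) \<Rightarrow> bool" where
  "log_concave_rv P X \<longleftrightarrow>
     (\<exists>f. log_concave_fun f \<and> (\<forall>n::int. \<P>(\<omega> in P. X \<omega> = n) = f (real_of_int n)))"

(* The supremum is a maximum: see max_prob_attained. *)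
definition max_prob :: "'a measure \<Rightarrow> ('a \<Rightarrow> int) \<Rightarrow> real" where
  "max_prob P X = (SUP n::int. \<P>(\<omega> in P. X \<omega> = n))"

(* geometric_pmf takes the success probability 1 - q as its parameter, so
   pmf (geometric_pmf (1 - q)) k = q ^ k * (1 - q). *)
definition geometric_up_to_translation_reflection :: "'a measure \<Rightarrow> ('a \<Rightarrow> int) \<Rightarrow> bool" where
  "geometric_up_to_translation_reflection P X \<longleftrightarrow>
     (\<exists>q\<in>{0..<1}. \<exists>m::int.
        distr P (count_space UNIV) X =
          measure_pmf (map_pmf (\<lambda>k. m + int k) (geometric_pmf (1 - q))) \<or>
        distr P (count_space UNIV) X =
          measure_pmf (map_pmf (\<lambda>k. m - int k) (geometric_pmf (1 - q))))"

lemma max_prob_attained: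
  fixes X :: "'a \<Rightarrow> int"
  assumes "prob_space P" and X: "X \<in> measurable P (count_space UNIV)"
  obtains m where "max_prob P X = \<P>(\<omega> in P. X \<omega> = m)"
    and "\<And>n. \<P>(\<omega> in P. X \<omega> = n) \<le> \<P>(\<omega> in P. X \<omega> = m)"
proof -
  interpret prob_space P by fact
  define E where "E n = {\<omega> \<in> space P. X \<omega> = n}" for n
  have E: "E n \<in> events" for n
    unfolding E_def using X by measurable
  have disj: "disjoint_family_on E A" for A
    by (auto simp: disjoint_family_on_def E_def)
  have "\<exists>k. prob (E k) > 0"
  proof (rule ccontr)
    assume "\<not> ?thesis"
    then have "prob (E k) = 0" for k
      by (meson measure_nonneg not_less order_antisym)
    then have "\<And>k. E k \<in> null_sets P"
      using E by (auto simp: null_sets_def emeasure_eq_measure)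
    then have "(\<Union>k. E k) \<in> null_sets P" by auto
    moreover have "(\<Union>k. E k) = space P" by (auto simp: E_def)
    ultimately show False using emeasure_space_1 by (auto simp: null_sets_def)
  qed
  then obtain k where k: "prob (E k) > 0" by blast
  define A where "A = {n. prob (E n) \<ge> prob (E k)}"
  have bound: "real (card B) * prob (E k) \<le> 1" if "finite B" "B \<subseteq> A" for B
  proof -
    have "real (card B) * prob (E k) = (\<Sum>n\<in>B. prob (E k))" by simp
    also have "\<dots> \<le> (\<Sum>n\<in>B. prob (E n))" using that by (intro sum_mono) (auto simp: A_def)
    also have "\<dots> = prob (\<Union>n\<in>B. E n)"
      using that E disj by (intro finite_measure_finite_Union[symmetric]) auto
    finally show ?thesis using prob_le_1 order_trans by blast
  qed
  have "finite A"
  proof (rule ccontr)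
    assume inf: "infinite A"
    obtain N :: nat where N: "real N * prob (E k) > 1"
      using k reals_Archimedean3 by blast
    obtain B where "finite B" "card B = N" "B \<subseteq> A"
      using infinite_arbitrarily_large[OF inf] by blast
    then show False using bound[of B] N by auto
  qed
  moreover have "A \<noteq> {}" by (auto simp: A_def)
  ultimately have "Max ((\<lambda>n. prob (E n)) ` A) \<in> (\<lambda>n. prob (E n)) ` A"
    by (intro Max_in) auto
  then obtain m where m: "m \<in> A" "Max ((\<lambda>n. prob (E n)) ` A) = prob (E m)"
    by blast
  have le: "prob (E n) \<le> prob (E m)" for n
  proof (cases "n \<in> A")
    case True
    then have "prob (E n) \<le> Max ((\<lambda>n. prob (E n)) ` A)"
      using \<open>finite A\<close> by (intro Max_ge) auto
    then show ?thesis using m by simp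
  next
    case False
    then show ?thesis using m(1) by (simp add: A_def)
  qed
  have "max_prob P X = prob (E m)"
    unfolding max_prob_def E_def[symmetric]
    using le by (intro cSup_eq_maximum) auto
  then show ?thesis using that[of m] le unfolding E_def by blast
qed

end

theory Submission
  imports Defs
begin

text \<open>
Let \<open>m\<close> be a point where the mass function of \<open>X\<close> attains its maximum \<open>M\<close>, and let
\<open>p k = P(X = m + k)\<close>, so that \<open>p 0 = M\<close>. The law of \<open>X\<close> is compared with a two-sided geometric law
\<open>q k = M * r ^ k\<close> for \<open>k \<ge> 0\<close> and \<open>q (- k) = M * s ^ k\<close>, which agrees with \<open>p\<close> at \<open>0\<close>. The two
ratios are chosen so that \<open>q\<close> has the same mass and the same mean \<open>\<mu>\<close> as \<open>p\<close>. In terms of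
\<open>R = 1 / (1 - r)\<close> and \<open>S = 1 / (1 - s)\<close> these are the linear conditions \<open>R + S - 1 = 1 / M\<close> and
\<open>R - S = \<mu>\<close>; they have a solution with \<open>R, S \<ge> 1\<close> because \<open>\<bar>\<mu>\<bar> \<le> 1 / M - 1\<close>
(\<open>log_concave_mean_bound\<close>).

On either side of \<open>0\<close> the sequence \<open>p\<close> is log-concave and \<open>q\<close> is log-affine, with equal values at
\<open>0\<close>. Hence, unless \<open>p = q\<close>, the difference \<open>q - p\<close> has the sign pattern \<open>+, -, 0, -, +\<close>, in the weak
sense, with one sign change on each side of \<open>0\<close>
(\<open>two_sided_geometric_crossings\<close>). As mass and mean agree, \<open>q\<close> dominates \<open>p\<close> in the convex order:
subtracting from a convex function its chord through the two crossing points makes all terms of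
the difference of expectations nonnegative (\<open>two_crossings_comparison\<close>). Hence the variance and the
fourth central moment of \<open>q\<close> are at least those of \<open>p\<close>, with equality only for \<open>p = q\<close>.

The law \<open>q\<close> is that of a difference of two independent geometric variables, with variances
\<open>v = R (R - 1)\<close> and \<open>w = S (S - 1)\<close>. It has variance \<open>v + w\<close> and fourth central moment
\<open>(v + w) + 9 (v + w)\<^sup>2 - 12 v w\<close>. For the geometric law with maximum \<open>M\<close> these moments are \<open>W\<close> and
\<open>W + 9 W\<^sup>2\<close>, where \<open>W = (1 - M) / M\<^sup>2\<close>. Since \<open>W - (v + w) = 2 (R - 1) (S - 1) \<ge> 0\<close>, both bounds
follow, and equality in either of them means that \<open>p = q\<close> and that one of the two ratios is \<open>0\<close>:
the law is geometric, up to translation and reflection.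
\<close>

section \<open>Moments of geometric sequences\<close>

lemma summable_power_times_geometric:
  fixes r :: real
  assumes "0 \<le> r" "r < 1"
  shows "summable (\<lambda>k. real k ^ j * r ^ k)"
  using assms
proof (induction j arbitrary: r)
  case 0
  then show ?case by (simp add: summable_geometric)
next
  case (Suc j)
  define t where "t = sqrt r"
  have t: "0 \<le> t" "t < 1" "r = t * t"
    using Suc.prems by (auto simp: t_def real_sqrt_lt_1_iff)
  have "Bseq (\<lambda>k. real k * t ^ k)"
    using powser_times_n_limit_0[of t] t by (intro convergent_imp_Bseq) (auto simp: convergent_def)
  then obtain K where K: "\<And>k. norm (real k * t ^ k) \<le> K"
    by (auto simp: Bseq_def)
  show ?case
  proof (rule summable_comparison_test')
    show "summable (\<lambda>k. K * (real k ^ j * t ^ k))"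
      by (intro summable_mult Suc.IH t)
    fix k :: nat
    have "norm (real k ^ Suc j * r ^ k) = norm (real k * t ^ k) * (real k ^ j * t ^ k)"
      using t(1) by (simp add: t(3) power_mult_distrib)
    also have "\<dots> \<le> K * (real k ^ j * t ^ k)"
      using K t by (intro mult_right_mono) auto
    finally show "norm (real k ^ Suc j * r ^ k) \<le> K * (real k ^ j * t ^ k)" .
  qed
qed

text \<open>Shifting the summation index by one leaves the sum unchanged for \<open>0 < j\<close>, because its term at
\<open>0\<close> vanishes. Expanding the shifted power by the binomial theorem gives
\<open>S j = r * (\<Sum>i\<le>j. (j choose i) * S i)\<close>, which is then solved for \<open>S j\<close>.\<close>

lemma geometric_moment_recurrence:
  fixes r :: real
  assumes r: "0 \<le> r" "r < 1" and j: "0 < j"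
  defines "S \<equiv> \<lambda>j. \<Sum>k. real k ^ j * r ^ k"
  shows "S j = (1 / (1 - r) - 1) * (\<Sum>i<j. real (j choose i) * S i)"
proof -
  have sm: "summable (\<lambda>k. real k ^ i * r ^ k)" for i
    by (rule summable_power_times_geometric[OF r])
  have "S j = (\<Sum>k. real (Suc k) ^ j * r ^ Suc k)"
    using suminf_split_head[OF sm[of j]] j by (simp add: S_def)
  also have "\<dots> = (\<Sum>k. \<Sum>i\<le>j. r * real (j choose i) * (real k ^ i * r ^ k))"
  proof (rule suminf_cong)
    fix k
    have "real (Suc k) ^ j = (\<Sum>i\<le>j. real (j choose i) * real k ^ i)"
      using binomial_ring[of "real k" 1 j] by (simp add: add.commute)
    then show "real (Suc k) ^ j * r ^ Suc k = (\<Sum>i\<le>j. r * real (j choose i) * (real k ^ i * r ^ k))"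
      by (simp add: sum_distrib_left sum_distrib_right mult_ac)
  qed
  also have "\<dots> = (\<Sum>i\<le>j. r * real (j choose i) * S i)"
    unfolding S_def using sm by (subst suminf_sum) (auto intro!: sum.cong suminf_mult summable_mult)
  also have "\<dots> = r * S j + r * (\<Sum>i<j. real (j choose i) * S i)"
    by (simp add: lessThan_Suc_atMost[symmetric] sum_distrib_left mult_ac algebra_simps)
  finally show ?thesis using r by (simp add: field_simps)
qed

text \<open>The parameter is the total mass \<open>R = 1 / (1 - r)\<close> rather than the ratio: the recurrence then
produces polynomials in \<open>R\<close>, and the sums below become polynomial identities.\<close>

lemma geometric_moments:
  fixes R :: real
  assumes "1 \<le> R"
  defines "r \<equiv> 1 - 1 / R"
  shows "((\<lambda>k. r ^ k) has_sum R) UNIV"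
    and "((\<lambda>k. real k * r ^ k) has_sum R * (R - 1)) UNIV"
    and "((\<lambda>k. real k ^ 2 * r ^ k) has_sum R * (R - 1) * (2 * R - 1)) UNIV"
    and "((\<lambda>k. real k ^ 3 * r ^ k) has_sum R * (R - 1) * (6 * R\<^sup>2 - 6 * R + 1)) UNIV"
    and "((\<lambda>k. real k ^ 4 * r ^ k)
           has_sum R * (R - 1) * (24 * R ^ 3 - 36 * R\<^sup>2 + 14 * R - 1)) UNIV"
proof -
  have r: "0 \<le> r" "r < 1" and R: "1 / (1 - r) = R"
    using assms by (auto simp: r_def field_simps)
  define S where "S j = (\<Sum>k. real k ^ j * r ^ k)" for j
  have S: "((\<lambda>k. real k ^ j * r ^ k) has_sum S j) UNIV" for j
    unfolding S_def using r
    by (intro sums_nonneg_imp_has_sum summable_sums summable_power_times_geometric) auto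
  have rec: "S j = (R - 1) * (\<Sum>i<j. real (j choose i) * S i)" if "0 < j" for j
    using geometric_moment_recurrence[OF r that] unfolding S_def R .
  have S0: "S 0 = R"
    using suminf_geometric[of r] r R by (simp add: S_def)
  have S1: "S 1 = R * (R - 1)"
    using rec[of 1] S0 by simp
  have S2: "S 2 = R * (R - 1) * (2 * R - 1)"
  proof -
    have "S 2 = (R - 1) * (S 0 + 2 * S 1)"
      using rec[of 2] by (simp add: eval_nat_numeral)
    then show ?thesis unfolding S0 S1 by (simp add: algebra_simps eval_nat_numeral)
  qed
  have S3: "S 3 = R * (R - 1) * (6 * R\<^sup>2 - 6 * R + 1)"
  proof -
    have "S 3 = (R - 1) * (S 0 + 3 * S 1 + 3 * S 2)"
      using rec[of 3] by (simp add: eval_nat_numeral)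
    then show ?thesis unfolding S0 S1 S2 by (simp add: algebra_simps eval_nat_numeral)
  qed
  have S4: "S 4 = R * (R - 1) * (24 * R ^ 3 - 36 * R\<^sup>2 + 14 * R - 1)"
  proof -
    have "S 4 = (R - 1) * (S 0 + 4 * S 1 + 6 * S 2 + 4 * S 3)"
      using rec[of 4] by (simp add: eval_nat_numeral)
    then show ?thesis unfolding S0 S1 S2 S3 by (simp add: algebra_simps eval_nat_numeral)
  qed
  show "((\<lambda>k. r ^ k) has_sum R) UNIV" using S[of 0] S0 by simp
  show "((\<lambda>k. real k * r ^ k) has_sum R * (R - 1)) UNIV" using S[of 1] S1 by simp
  show "((\<lambda>k. real k ^ 2 * r ^ k) has_sum R * (R - 1) * (2 * R - 1)) UNIV"
    using S[of 2] S2 by simp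
  show "((\<lambda>k. real k ^ 3 * r ^ k) has_sum R * (R - 1) * (6 * R\<^sup>2 - 6 * R + 1)) UNIV"
    using S[of 3] S3 by simp
  show "((\<lambda>k. real k ^ 4 * r ^ k)
           has_sum R * (R - 1) * (24 * R ^ 3 - 36 * R\<^sup>2 + 14 * R - 1)) UNIV"
    using S[of 4] S4 by simp
qed

section \<open>Sums over the integers\<close>

lemma has_sum_diff:
  fixes f g :: "'a \<Rightarrow> real"
  assumes "(f has_sum a) A" "(g has_sum b) A"
  shows "((\<lambda>x. f x - g x) has_sum (a - b)) A"
  using has_sum_add[OF assms(1), of "\<lambda>x. - g x" "- b"] assms(2) by (simp add: has_sum_uminus)

lemma has_sum_int_split:
  fixes f :: "int \<Rightarrow> real"
  assumes right: "((\<lambda>n. f (int n)) has_sum a) UNIV"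
    and left: "((\<lambda>n. f (- int n)) has_sum b) UNIV"
  shows "(f has_sum (a + b - f 0)) UNIV"
proof -
  have "(f has_sum a) (range int)"
    using right by (subst has_sum_reindex) (auto simp: o_def)
  moreover have "(f has_sum b) (range (\<lambda>n. - int n))"
    using left by (subst has_sum_reindex) (auto simp: o_def inj_on_def)
  then have "(f has_sum (b - f 0)) (range (\<lambda>n. - int n) - {0})"
    by (intro has_sum_Diff) (auto intro!: has_sum_finiteI image_eqI[of _ _ 0])
  ultimately have "(f has_sum (a + (b - f 0))) (range int \<union> (range (\<lambda>n. - int n) - {0}))"
    by (intro has_sum_Un_disjoint) auto
  moreover have "range int \<union> (range (\<lambda>n. - int n) - {0}) = UNIV"
  proof -
    have "k \<in> range int \<union> (range (\<lambda>n. - int n) - {0})" for k :: int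
      by (cases k rule: int_cases2) auto
    then show ?thesis by auto
  qed
  ultimately show ?thesis by (simp add: algebra_simps)
qed

lemma has_sum_int_halves:
  fixes f :: "int \<Rightarrow> real"
  assumes "(f has_sum c) UNIV"
  obtains a b where "((\<lambda>n. f (int n)) has_sum a) UNIV" "((\<lambda>n. f (- int n)) has_sum b) UNIV"
    "c = a + b - f 0"
proof -
  have "f summable_on A" for A
    using assms summable_on_subset_banach[of f UNIV A] by (auto simp: summable_on_def)
  then have "f summable_on (range int)" "f summable_on (range (\<lambda>n. - int n))" by auto
  moreover have "inj int" "inj (\<lambda>n. - int n)" by (auto simp: inj_on_def)
  ultimately have "(\<lambda>n. f (int n)) summable_on UNIV" "(\<lambda>n. f (- int n)) summable_on UNIV"
    by (simp_all add: summable_on_reindex o_def)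
  then obtain a b where ab: "((\<lambda>n. f (int n)) has_sum a) UNIV" "((\<lambda>n. f (- int n)) has_sum b) UNIV"
    by (auto simp: summable_on_def)
  with has_sum_int_split[OF this] assms show ?thesis
    using has_sum_unique that by blast
qed

section \<open>Log-concave sequences against geometric sequences\<close>

text \<open>The form of log-concavity on which the comparison rests. A geometric sequence is log-affine, so a
log-concave sequence that has the same value at \<open>0\<close> and is not below it at \<open>l\<close> cannot be below it
in between. Quantifying over the ratio \<open>r\<close> says \<open>u n \<ge> u 0 powr (1 - n/l) * u l powr (n/l)\<close>
without real exponents.\<close>

definition log_concave_at_start :: "(nat \<Rightarrow> real) \<Rightarrow> bool" where
  "log_concave_at_start u \<longleftrightarrow> 0 < u 0 \<and> (\<forall>n. 0 \<le> u n) \<and>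
     (\<forall>r\<ge>0. \<forall>n l. n \<le> l \<longrightarrow> u 0 * r ^ l \<le> u l \<longrightarrow> u 0 * r ^ n \<le> u n)"

lemma log_concave_at_startD:
  assumes "log_concave_at_start u" "0 \<le> r" "n \<le> l" "u n < u 0 * r ^ n"
  shows "u l < u 0 * r ^ l"
  using assms unfolding log_concave_at_start_def by (meson not_le)

text \<open>The step \<open>c\<close> will be \<open>1\<close> or \<open>-1\<close>: the two halves of a mass function on the integers, read
outwards from the point \<open>a\<close>.\<close>

lemma log_concave_at_start_if_log_concave_fun:
  assumes f: "log_concave_fun f" and pos: "0 < f a"
  shows "log_concave_at_start (\<lambda>n. f (a + c * real n))"
  unfolding log_concave_at_start_def
proof (intro conjI allI impI)
  have nonneg: "0 \<le> f x" for x using f by (simp add: log_concave_fun_def)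
  show "0 < f (a + c * real 0)" using pos by simp
  show "0 \<le> f (a + c * real n)" for n by (rule nonneg)
  fix r :: real and n l :: nat
  assume r: "0 \<le> r" and nl: "n \<le> l" and le: "f (a + c * real 0) * r ^ l \<le> f (a + c * real l)"
  show "f (a + c * real 0) * r ^ n \<le> f (a + c * real n)"
  proof (cases "n = 0 \<or> r = 0")
    case True
    then show ?thesis using nonneg by (cases "n = 0") (auto simp: power_0_left)
  next
    case False
    with r nl have r: "0 < r" and l: "0 < l" and n: "0 < n" by auto
    define s where "s = real n / real l"
    have s: "0 \<le> s" "s \<le> 1" and sl: "s * real l = real n"
      using nl l by (auto simp: s_def)
    have "(r ^ l) powr s = r powr (s * real l)"
      using r by (simp add: powr_realpow[symmetric] powr_powr mult.commute)
    also have "\<dots> = r ^ n" using r by (simp add: sl powr_realpow)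
    finally have "f a powr (1 - s) * (f a * r ^ l) powr s = f a powr (1 - s) * f a powr s * r ^ n"
      using pos r by (simp add: powr_mult)
    also have "f a powr (1 - s) * f a powr s = f a"
      using pos by (simp flip: powr_add)
    finally have "f a * r ^ n = f a powr (1 - s) * (f a * r ^ l) powr s" by simp
    also have "\<dots> \<le> f a powr (1 - s) * f (a + c * real l) powr s"
      using le s pos r by (intro mult_left_mono powr_mono2) auto
    also have "\<dots> \<le> f ((1 - s) * a + s * (a + c * real l))"
      using f s by (simp add: log_concave_fun_def)
    also have "(1 - s) * a + s * (a + c * real l) = a + c * real n"
      unfolding sl[symmetric] by (simp add: algebra_simps)
    finally show ?thesis by simp
  qed
qed

text \<open>Once the sequence has fallen strictly below the geometric one, it stays below. The crossing point
\<open>b\<close> is taken half-way between two integers, so that the factor \<open>real k - b\<close> never vanishes; this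
is what makes the equality cases accessible later.\<close>

lemma geometric_single_crossing:
  assumes u: "log_concave_at_start u" and r: "0 \<le> r"
  shows "(\<forall>k. u 0 * r ^ k \<le> u k) \<or>
    (\<exists>b>0. \<forall>k. real k \<noteq> b \<and> 0 \<le> (u 0 * r ^ k - u k) * (real k - b))"
proof (cases "\<forall>k. u 0 * r ^ k \<le> u k")
  case False
  define l where "l = (LEAST k. u k < u 0 * r ^ k)"
  have l: "u l < u 0 * r ^ l"
    unfolding l_def by (rule LeastI_ex[of "\<lambda>k. u k < u 0 * r ^ k"]) (use False in \<open>simp add: not_le\<close>)
  then have "0 < l" by (cases l) auto
  have "real k \<noteq> real l - 1/2 \<and> 0 \<le> (u 0 * r ^ k - u k) * (real k - (real l - 1/2))" for k
  proof (cases "k < l")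
    case True
    then have "u 0 * r ^ k \<le> u k"
      unfolding l_def using not_less_Least not_le by blast
    then show ?thesis using True by (auto intro!: mult_nonpos_nonpos)
  next
    case False
    have "u k < u 0 * r ^ k"
      using log_concave_at_startD[OF u r _ l] False by simp
    then show ?thesis using False by (auto intro!: mult_nonneg_nonneg)
  qed
  then show ?thesis using \<open>0 < l\<close> by (intro disjI2 exI[of _ "real l - 1/2"]) auto
qed simp

text \<open>A log-concave sequence that tends to \<open>0\<close> decays geometrically: as soon as it has dropped below half
of its initial value, the geometric sequence that reaches this half at the same place dominates
it from there on.\<close>

lemma summable_moments_if_log_concave_at_start:
  assumes u: "log_concave_at_start u" and "summable u"
  shows "summable (\<lambda>k. real k ^ j * u k)"
proof -
  have u0: "0 < u 0" using u by (simp add: log_concave_at_start_def)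
  have "eventually (\<lambda>n. u n < u 0 / 2) sequentially"
    using summable_LIMSEQ_zero[OF assms(2)] u0 by (intro order_tendstoD) auto
  then obtain n where n: "0 < n" "u n < u 0 / 2"
    by (metis eventually_sequentially le_add1 le_add2 zero_less_Suc less_le_trans plus_1_eq_Suc)
  define r where "r = root n (1/2)"
  have r: "0 \<le> r" "r < 1" "r ^ n = 1/2" using n by (auto simp: r_def)
  have "u k \<le> u 0 * r ^ k" if "n \<le> k" for k
    using log_concave_at_startD[OF u r(1) that] n r by simp
  moreover have "0 \<le> u k" for k using u by (simp add: log_concave_at_start_def)
  ultimately have "norm (real k ^ j * u k) \<le> u 0 * (real k ^ j * r ^ k)" if "n \<le> k" for k
    using that mult_left_mono[of "u k" "u 0 * r ^ k" "real k ^ j"] by (simp add: mult_ac)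
  then show ?thesis
    by (rule summable_comparison_test'[OF summable_mult[OF summable_power_times_geometric[OF r(1,2)]]])
qed

lemma start_le_has_sum:
  fixes u :: "nat \<Rightarrow> real"
  assumes "(u has_sum A) UNIV" "\<And>n. 0 \<le> u n"
  shows "u 0 \<le> A"
  using has_sum_mono_neutral[OF has_sum_finite[of "{0}" u] assms(1)] assms(2) by auto

text \<open>The bound is the first moment of the geometric sequence with initial value \<open>u 0\<close> and total mass
\<open>1\<close>. Against it the sequence has at most one crossing, so the geometric sequence has its mass
further out.\<close>

lemma first_moment_le_if_log_concave_at_start:
  assumes u: "log_concave_at_start u" and A: "(u has_sum A) UNIV" "A \<le> 1"
    and E: "((\<lambda>k. real k * u k) has_sum E) UNIV"
  shows "E \<le> 1 / u 0 - 1"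
proof -
  define R where "R = 1 / u 0"
  define r where "r = 1 - 1 / R"
  have nonneg: "0 \<le> u k" and u0: "0 < u 0" for k using u by (auto simp: log_concave_at_start_def)
  have "u 0 \<le> A"
    by (rule start_le_has_sum[OF A(1) nonneg])
  then have "1 \<le> R" using A u0 by (simp add: R_def field_simps)
  have r: "0 \<le> r" using \<open>1 \<le> R\<close> by (simp add: r_def)
  note geo = geometric_moments(1,2)[OF \<open>1 \<le> R\<close>, folded r_def]
  have g0: "((\<lambda>k. u 0 * r ^ k) has_sum 1) UNIV"
    using has_sum_cmult_right[OF geo(1), of "u 0"] u0 by (simp add: R_def)
  have g1: "((\<lambda>k. real k * (u 0 * r ^ k)) has_sum (R - 1)) UNIV"
    using has_sum_cmult_right[OF geo(2), of "u 0"] u0 by (simp add: R_def mult_ac)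
  consider (above) "\<forall>k. u 0 * r ^ k \<le> u k"
    | (crossing) b where "b > 0" "\<And>k. 0 \<le> (u 0 * r ^ k - u k) * (real k - b)"
    using geometric_single_crossing[OF u r] by blast
  then have "E \<le> R - 1"
  proof cases
    case above
    have d: "((\<lambda>k. u k - u 0 * r ^ k) has_sum A - 1) UNIV"
      by (intro has_sum_diff A g0)
    have "u k - u 0 * r ^ k = 0" for k
      by (rule nonneg_has_sum_le_0D[OF d]) (use above A in auto)
    from eq_iff_diff_eq_0[THEN iffD2, OF this] have "u k = u 0 * r ^ k" for k .
    then have "(\<lambda>k. real k * u k) = (\<lambda>k. real k * (u 0 * r ^ k))" by metis
    then show ?thesis using has_sum_unique[OF E] g1 by (metis order_refl)
  next
    case crossing
    have "((\<lambda>k. real k * (u 0 * r ^ k) - real k * u k - b * (u 0 * r ^ k - u k))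
        has_sum (R - 1) - E - b * (1 - A)) UNIV"
      by (intro has_sum_diff has_sum_cmult_right A g0 g1 E)
    then have "0 \<le> (R - 1) - E - b * (1 - A)"
      by (rule has_sum_nonneg) (use crossing in \<open>simp add: algebra_simps\<close>)
    moreover have "0 \<le> b * (1 - A)" using A crossing by simp
    ultimately show ?thesis by simp
  qed
  then show ?thesis by (simp add: R_def)
qed

section \<open>Two-sided geometric distributions\<close>

definition two_sided_geometric :: "real \<Rightarrow> real \<Rightarrow> real \<Rightarrow> int \<Rightarrow> real" where
  "two_sided_geometric M r s k = M * (if 0 \<le> k then r ^ nat k else s ^ nat (- k))"

lemma two_sided_geometric_0 [simp]: "two_sided_geometric M r s 0 = M"
  by (simp add: two_sided_geometric_def)

lemma two_sided_geometric_int [simp]: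
  "two_sided_geometric M r s (int n) = M * r ^ n"
  "two_sided_geometric M r s (- int n) = M * s ^ n"
  by (auto simp: two_sided_geometric_def)

lemma has_sum_central_moments:
  fixes p :: "int \<Rightarrow> real"
  assumes "(p has_sum 1) UNIV"
    and "((\<lambda>k. p k * real_of_int k) has_sum e1) UNIV"
    and "((\<lambda>k. p k * real_of_int k ^ 2) has_sum e2) UNIV"
    and "((\<lambda>k. p k * real_of_int k ^ 3) has_sum e3) UNIV"
    and "((\<lambda>k. p k * real_of_int k ^ 4) has_sum e4) UNIV"
  shows "((\<lambda>k. p k * (real_of_int k - e1) ^ 2) has_sum e2 - e1 ^ 2) UNIV"
    and "((\<lambda>k. p k * (real_of_int k - e1) ^ 4) has_sum
           e4 - 4 * e1 * e3 + 6 * e1 ^ 2 * e2 - 3 * e1 ^ 4) UNIV"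
proof -
  have "((\<lambda>k. p k * real_of_int k ^ 2 + (- 2 * e1) * (p k * real_of_int k) + e1 ^ 2 * p k)
      has_sum (e2 + (- 2 * e1) * e1 + e1 ^ 2 * 1)) UNIV"
    by (intro has_sum_add has_sum_cmult_right assms)
  then show "((\<lambda>k. p k * (real_of_int k - e1) ^ 2) has_sum e2 - e1 ^ 2) UNIV"
    by (simp add: power2_eq_square algebra_simps)
  have "((\<lambda>k. p k * real_of_int k ^ 4 + (- 4 * e1) * (p k * real_of_int k ^ 3)
        + (6 * e1 ^ 2) * (p k * real_of_int k ^ 2) + (- 4 * e1 ^ 3) * (p k * real_of_int k)
        + e1 ^ 4 * p k)
      has_sum (e4 + (- 4 * e1) * e3 + (6 * e1 ^ 2) * e2 + (- 4 * e1 ^ 3) * e1 + e1 ^ 4 * 1)) UNIV"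
    by (intro has_sum_add has_sum_cmult_right assms)
  then show "((\<lambda>k. p k * (real_of_int k - e1) ^ 4) has_sum
           e4 - 4 * e1 * e3 + 6 * e1 ^ 2 * e2 - 3 * e1 ^ 4) UNIV"
    by (simp add: eval_nat_numeral algebra_simps)
qed

text \<open>With \<open>R = 1 / (1 - r)\<close> and \<open>S = 1 / (1 - s)\<close>, the law with weight \<open>1 / (R + S - 1)\<close> at \<open>0\<close> is that
of the difference of two independent geometric variables with ratios \<open>r\<close> and \<open>s\<close>, whose variances
are \<open>v\<close> and \<open>w\<close>. A geometric variable of variance \<open>v\<close> has fourth central moment \<open>v + 9 v\<^sup>2\<close>, so
the difference has \<open>v + 9 v\<^sup>2 + w + 9 w\<^sup>2 + 6 v w\<close>. The proof sums directly: apart from the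
weight, each raw moment is a polynomial in \<open>R\<close> and \<open>S\<close> that is divisible by \<open>R + S - 1\<close>.\<close>

lemma two_sided_geometric_moments:
  fixes R S :: real
  assumes R: "1 \<le> R" and S: "1 \<le> S"
  defines "q \<equiv> two_sided_geometric (1 / (R + S - 1)) (1 - 1 / R) (1 - 1 / S)"
    and "v \<equiv> R * (R - 1)" and "w \<equiv> S * (S - 1)"
  shows "(q has_sum 1) UNIV"
    and "((\<lambda>k. q k * real_of_int k) has_sum R - S) UNIV"
    and "((\<lambda>k. q k * (real_of_int k - (R - S)) ^ 2) has_sum v + w) UNIV"
    and "((\<lambda>k. q k * (real_of_int k - (R - S)) ^ 4) has_sum
           v + w + 9 * (v + w)\<^sup>2 - 12 * v * w) UNIV"
proof -
  define N where "N = R + S - 1"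
  have N: "N \<noteq> 0" using R S by (simp add: N_def)
  note gR = geometric_moments[OF R] and gS = geometric_moments[OF S]
  have split: "((\<lambda>k. q k * real_of_int k ^ j) has_sum (a + (- 1) ^ j * b - 0 ^ j) / N) UNIV"
    if "((\<lambda>k. real k ^ j * (1 - 1 / R) ^ k) has_sum a) UNIV"
      "((\<lambda>k. real k ^ j * (1 - 1 / S) ^ k) has_sum b) UNIV" for j a b
  proof -
    have "((\<lambda>n. q (int n) * real_of_int (int n) ^ j) has_sum (1 / N) * a) UNIV"
      using has_sum_cmult_right[OF that(1), of "1 / N"] by (simp add: q_def N_def mult_ac)
    moreover have "((\<lambda>n. q (- int n) * real_of_int (- int n) ^ j) has_sum ((- 1) ^ j / N) * b) UNIV"
      using has_sum_cmult_right[OF that(2), of "(- 1) ^ j / N"]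
      by (simp add: q_def N_def mult_ac power_minus[of "real _"])
    ultimately have "((\<lambda>k. q k * real_of_int k ^ j) has_sum
        ((1 / N) * a + ((- 1) ^ j / N) * b - q 0 * real_of_int 0 ^ j)) UNIV"
      by (rule has_sum_int_split)
    then show ?thesis by (simp add: q_def N_def diff_divide_distrib add_divide_distrib)
  qed
  have "((\<lambda>k. q k * real_of_int k ^ 0) has_sum (R + (- 1) ^ 0 * S - 0 ^ 0) / N) UNIV"
    using gR(1) gS(1) by (intro split) auto
  then show m0: "(q has_sum 1) UNIV" using N by (simp add: N_def)
  have "((\<lambda>k. q k * real_of_int k ^ 1) has_sum (v + (- 1) ^ 1 * w - 0 ^ 1) / N) UNIV"
    using gR(2) gS(2) by (intro split) (auto simp: v_def w_def)
  moreover have "v - w = (R - S) * N" by (simp add: v_def w_def N_def algebra_simps)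
  ultimately show m1: "((\<lambda>k. q k * real_of_int k) has_sum R - S) UNIV" using N by simp
  let ?e2 = "2 * (R\<^sup>2 - R * S + S\<^sup>2) - R - S"
  have "((\<lambda>k. q k * real_of_int k ^ 2) has_sum
      (v * (2 * R - 1) + (- 1) ^ 2 * (w * (2 * S - 1)) - 0 ^ 2) / N) UNIV"
    using gR(3) gS(3) by (intro split) (auto simp: v_def w_def)
  moreover have "v * (2 * R - 1) + w * (2 * S - 1) = ?e2 * N"
    by (simp add: v_def w_def N_def algebra_simps eval_nat_numeral)
  ultimately have m2: "((\<lambda>k. q k * real_of_int k ^ 2) has_sum ?e2) UNIV" using N by simp
  let ?e3 = "(R - S) * (6 * (v + w) + 1)"
  have "((\<lambda>k. q k * real_of_int k ^ 3) has_sum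
      (v * (6 * R\<^sup>2 - 6 * R + 1) + (- 1) ^ 3 * (w * (6 * S\<^sup>2 - 6 * S + 1)) - 0 ^ 3) / N) UNIV"
    using gR(4) gS(4) by (intro split) (auto simp: v_def w_def)
  moreover have "v * (6 * R\<^sup>2 - 6 * R + 1) - w * (6 * S\<^sup>2 - 6 * S + 1) = ?e3 * N"
    by (simp add: v_def w_def N_def algebra_simps eval_nat_numeral)
  ultimately have m3: "((\<lambda>k. q k * real_of_int k ^ 3) has_sum ?e3) UNIV" using N by simp
  \<comment> \<open>The two fourth moments are the same odd polynomial in \<open>x\<close> and in \<open>y\<close>, so \<open>x + y = N\<close> divides their sum.\<close>
  define x y where "x = R - 1 / 2" and "y = S - 1 / 2"
  let ?e4 = "24 * (x^4 - x^3 * y + x^2 * y^2 - x * y^3 + y^4) - 10 * (x^2 - x * y + y^2) + 1"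
  have RS: "R = x + 1 / 2" "S = y + 1 / 2" by (auto simp: x_def y_def)
  have "((\<lambda>k. q k * real_of_int k ^ 4) has_sum
      (v * (24 * R ^ 3 - 36 * R\<^sup>2 + 14 * R - 1)
        + (- 1) ^ 4 * (w * (24 * S ^ 3 - 36 * S\<^sup>2 + 14 * S - 1)) - 0 ^ 4) / N) UNIV"
    using gR(5) gS(5) by (intro split) (auto simp: v_def w_def)
  moreover have "v * (24 * R ^ 3 - 36 * R\<^sup>2 + 14 * R - 1)
      + w * (24 * S ^ 3 - 36 * S\<^sup>2 + 14 * S - 1) = ?e4 * N"
    unfolding v_def w_def N_def RS by (simp add: field_simps eval_nat_numeral)
  ultimately have m4: "((\<lambda>k. q k * real_of_int k ^ 4) has_sum ?e4) UNIV" using N by simp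
  note central = has_sum_central_moments[OF m0 m1 m2 m3 m4]
  have "?e2 - (R - S) ^ 2 = v + w"
    by (simp add: v_def w_def algebra_simps eval_nat_numeral)
  then show "((\<lambda>k. q k * (real_of_int k - (R - S)) ^ 2) has_sum v + w) UNIV"
    using central(1) by simp
  have "?e4 - 4 * (R - S) * ?e3 + 6 * (R - S) ^ 2 * ?e2 - 3 * (R - S) ^ 4
      = v + w + 9 * (v + w)\<^sup>2 - 12 * v * w"
    unfolding v_def w_def RS by (simp add: field_simps eval_nat_numeral)
  then show "((\<lambda>k. q k * (real_of_int k - (R - S)) ^ 4) has_sum
           v + w + 9 * (v + w)\<^sup>2 - 12 * v * w) UNIV"
    using central(2) by simp
qed

section \<open>Comparison by sign changes\<close>

text \<open>\<open>D\<close> is the difference of two laws with the same mean. An affine function can be subtracted from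
\<open>g\<close> without changing the sum of \<open>D k * g k\<close>; with the chord of \<open>g\<close> through the two points where
\<open>D\<close> changes sign, every remaining term is nonnegative. As no integer is a crossing point, the sum
vanishes only if \<open>D\<close> does.\<close>

lemma two_crossings_comparison:
  fixes D g h :: "int \<Rightarrow> real"
  assumes mass: "(D has_sum 0) UNIV" and mean: "((\<lambda>k. D k * real_of_int k) has_sum 0) UNIV"
    and sign: "\<And>k. 0 \<le> D k * ((real_of_int k - a) * (real_of_int k - b))"
    and ne: "\<And>k. real_of_int k \<noteq> a" "\<And>k. real_of_int k \<noteq> b"
    and chord: "\<And>k. g k = (real_of_int k - a) * (real_of_int k - b) * h k + \<alpha> * real_of_int k + \<beta>"
    and pos: "\<And>k. 0 < h k"
    and c: "((\<lambda>k. D k * g k) has_sum c) UNIV"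
  shows "0 \<le> c" and "c = 0 \<Longrightarrow> D k = 0"
proof -
  have "((\<lambda>k. D k * g k - \<alpha> * (D k * real_of_int k) - \<beta> * D k) has_sum c - \<alpha> * 0 - \<beta> * 0) UNIV"
    by (intro has_sum_diff has_sum_cmult_right mass mean c)
  then have sum: "((\<lambda>k. D k * ((real_of_int k - a) * (real_of_int k - b)) * h k) has_sum c) UNIV"
    by (simp add: chord algebra_simps)
  have nonneg: "0 \<le> D k * ((real_of_int k - a) * (real_of_int k - b)) * h k" for k
    by (rule mult_nonneg_nonneg[OF sign less_imp_le[OF pos]])
  show "0 \<le> c" by (rule has_sum_nonneg[OF sum]) (rule nonneg)
  assume "c = 0"
  then have "D k * ((real_of_int k - a) * (real_of_int k - b)) * h k = 0"
    using nonneg_has_sum_le_0D[OF sum] nonneg by auto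
  then show "D k = 0" using ne[of k] pos[of k] by auto
qed

text \<open>The quadratic is \<open>(x\<^sup>4 - chord) / ((x - y) * (x - z))\<close>, for the chord of the fourth power through
\<open>y\<close> and \<open>z\<close>.\<close>

lemma quartic_chord_quotient_pos:
  fixes x y z :: real
  assumes "y \<noteq> z"
  shows "0 < x\<^sup>2 + (y + z) * x + (y\<^sup>2 + y * z + z\<^sup>2)"
proof -
  have "0 < (2 * x + y + z)\<^sup>2 + (y + z)\<^sup>2 + y\<^sup>2 + z\<^sup>2"
    using assms by (smt (verit) zero_le_power2 zero_less_power2)
  also have "\<dots> \<le> 4 * (x\<^sup>2 + (y + z) * x + (y\<^sup>2 + y * z + z\<^sup>2))"
    using zero_le_power2[of "y + z"] by (simp add: power2_eq_square algebra_simps)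
  finally show ?thesis by simp
qed

text \<open>A difference of two laws with equal means cannot change sign exactly once. The constant \<open>c\<close> carries
the orientation of the sign change.\<close>

lemma balanced_single_crossing:
  fixes D :: "int \<Rightarrow> real"
  assumes mass: "(D has_sum 0) UNIV" and mean: "((\<lambda>k. D k * real_of_int k) has_sum 0) UNIV"
    and sign: "\<And>k. 0 \<le> c * (D k * (real_of_int k - a))" and ne: "c \<noteq> 0" "\<And>k. real_of_int k \<noteq> a"
  shows "D k = 0"
proof -
  have "((\<lambda>k. c * (D k * real_of_int k - a * D k)) has_sum c * (0 - a * 0)) UNIV"
    by (intro has_sum_diff has_sum_cmult_right mass mean)
  then have sum: "((\<lambda>k. c * (D k * (real_of_int k - a))) has_sum 0) UNIV"
    by (simp add: algebra_simps)
  have "c * (D k * (real_of_int k - a)) = 0"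
    using nonneg_has_sum_le_0D[OF sum] sign by auto
  then show ?thesis using ne by simp
qed

text \<open>Going outwards from \<open>0\<close> in either direction, \<open>D\<close> is first nonpositive and then nonnegative, unless
it stays nonpositive. If both outer crossings exist, these are \<open>a < 0 < b\<close>. If at least one is
missing, then \<open>D\<close> changes sign at most once and vanishes, because its mass and mean are zero.\<close>

lemma two_sided_geometric_crossings:
  fixes p :: "int \<Rightarrow> real"
  assumes right: "log_concave_at_start (\<lambda>n. p (int n))"
    and left: "log_concave_at_start (\<lambda>n. p (- int n))"
    and rs: "0 \<le> r" "0 \<le> s"
  defines "D \<equiv> \<lambda>k. two_sided_geometric (p 0) r s k - p k"
  assumes mass: "(D has_sum 0) UNIV" and mean: "((\<lambda>k. D k * real_of_int k) has_sum 0) UNIV"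
  obtains (equal) "D = (\<lambda>_. 0)"
  | (crossings) a b where "a < b" "\<And>k. real_of_int k \<noteq> a" "\<And>k. real_of_int k \<noteq> b"
      "\<And>k. 0 \<le> D k * ((real_of_int k - a) * (real_of_int k - b))"
proof -
  have int_cases': "P k" if "\<And>n. P (int n)" "\<And>n. P (- int n)" for P and k :: int
    using that by (cases k rule: int_cases2) auto
  have D: "D (int n) = p 0 * r ^ n - p (int n)" "D (- int n) = p 0 * s ^ n - p (- int n)" for n
    by (simp_all add: D_def)
  have R: "(\<forall>n. D (int n) \<le> 0) \<or> (\<exists>b>0. \<forall>n. real n \<noteq> b \<and> 0 \<le> D (int n) * (real n - b))"
    using geometric_single_crossing[OF right rs(1)] by (simp add: D)
  have L: "(\<forall>n. D (- int n) \<le> 0) \<or> (\<exists>c>0. \<forall>n. real n \<noteq> c \<and> 0 \<le> D (- int n) * (real n - c))"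
    using geometric_single_crossing[OF left rs(2)] by (simp add: D)
  consider (aa) "\<And>n. D (int n) \<le> 0" "\<And>n. D (- int n) \<le> 0"
    | (ac) c where "\<And>n. D (int n) \<le> 0" "c > 0" "\<And>n. real n \<noteq> c" "\<And>n. 0 \<le> D (- int n) * (real n - c)"
    | (ca) b where "b > 0" "\<And>n. real n \<noteq> b" "\<And>n. 0 \<le> D (int n) * (real n - b)" "\<And>n. D (- int n) \<le> 0"
    | (cc) b c where "b > 0" "\<And>n. real n \<noteq> b" "\<And>n. 0 \<le> D (int n) * (real n - b)"
        "c > 0" "\<And>n. real n \<noteq> c" "\<And>n. 0 \<le> D (- int n) * (real n - c)"
    using R L by blast
  then show thesis
  proof cases
    case aa
    have "D k = 0" for k
    proof -
      have sum: "((\<lambda>k. - D k) has_sum 0) UNIV"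
        using mass by (simp add: has_sum_uminus)
      have "0 \<le> - D k" for k by (rule int_cases') (use aa in auto)
      then show ?thesis using nonneg_has_sum_le_0D[OF sum] by auto
    qed
    then show ?thesis by (intro equal ext)
  next
    case ac
    have "real_of_int k \<noteq> - c" for k
      by (rule int_cases') (use ac(2,3) in \<open>auto simp: neq_iff\<close>)
    moreover have "0 \<le> (- 1) * (D k * (real_of_int k - (- c)))" for k
    proof (rule int_cases')
      fix n
      show "0 \<le> (- 1) * (D (int n) * (real_of_int (int n) - (- c)))"
        using mult_nonpos_nonneg[OF ac(1)[of n], of "real n + c"] ac(2) by simp
      show "0 \<le> (- 1) * (D (- int n) * (real_of_int (- int n) - (- c)))"
        using ac(4)[of n] by (simp add: algebra_simps)
    qed
    ultimately have "D k = 0" for k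
      using balanced_single_crossing[OF mass mean, of "- 1" "- c"] by (metis neg_equal_0_iff_equal zero_neq_one)
    then show ?thesis by (intro equal ext)
  next
    case ca
    have "real_of_int k \<noteq> b" for k
      by (rule int_cases') (use ca(1,2) in \<open>auto simp: neq_iff\<close>)
    moreover have "0 \<le> 1 * (D k * (real_of_int k - b))" for k
    proof (rule int_cases')
      fix n
      show "0 \<le> 1 * (D (int n) * (real_of_int (int n) - b))"
        using ca(3) by simp
      show "0 \<le> 1 * (D (- int n) * (real_of_int (- int n) - b))"
        using mult_nonpos_nonpos[OF ca(4)[of n], of "- real n - b"] ca(1) by simp
    qed
    ultimately have "D k = 0" for k
      using balanced_single_crossing[OF mass mean, of 1 b] by (metis zero_neq_one)
    then show ?thesis by (intro equal ext)
  next
    case cc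
    show ?thesis
    proof (rule crossings)
      show "- c < b" using cc by simp
      show "real_of_int k \<noteq> - c" for k
        by (rule int_cases') (use cc(4,5) in \<open>auto simp: neq_iff\<close>)
      show "real_of_int k \<noteq> b" for k
        by (rule int_cases') (use cc(1,2) in \<open>auto simp: neq_iff\<close>)
      show "0 \<le> D k * ((real_of_int k - (- c)) * (real_of_int k - b))" for k
      proof (rule int_cases')
        fix n
        show "0 \<le> D (int n) * ((real_of_int (int n) - (- c)) * (real_of_int (int n) - b))"
          using mult_nonneg_nonneg[OF cc(3)[of n], of "real n + c"] cc(4) by (simp add: mult_ac)
        show "0 \<le> D (- int n) * ((real_of_int (- int n) - (- c)) * (real_of_int (- int n) - b))"
          using mult_nonneg_nonneg[OF cc(6)[of n], of "real n + b"] cc(1) by (simp add: algebra_simps)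
      qed
    qed
  qed
qed

section \<open>Central moments of log-concave laws\<close>

lemma log_concave_moment_has_sum:
  fixes p :: "int \<Rightarrow> real"
  assumes right: "log_concave_at_start (\<lambda>n. p (int n))"
    and left: "log_concave_at_start (\<lambda>n. p (- int n))"
    and mass: "(p has_sum 1) UNIV"
  shows "\<exists>e. ((\<lambda>k. p k * real_of_int k ^ j) has_sum e) UNIV"
proof -
  obtain A B where A: "((\<lambda>n. p (int n)) has_sum A) UNIV" and B: "((\<lambda>n. p (- int n)) has_sum B) UNIV"
    using has_sum_int_halves[OF mass] by blast
  have nonneg: "0 \<le> p (int n)" "0 \<le> p (- int n)" for n
    using right left by (simp_all add: log_concave_at_start_def)
  have "summable (\<lambda>n. real n ^ j * p (int n))" "summable (\<lambda>n. real n ^ j * p (- int n))"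
    using has_sum_imp_sums[OF A] has_sum_imp_sums[OF B]
    by (auto intro!: summable_moments_if_log_concave_at_start[OF right]
        summable_moments_if_log_concave_at_start[OF left] simp: sums_iff)
  then obtain a b where "((\<lambda>n. real n ^ j * p (int n)) has_sum a) UNIV"
    "((\<lambda>n. real n ^ j * p (- int n)) has_sum b) UNIV"
    using nonneg by (meson mult_nonneg_nonneg of_nat_0_le_iff sums_nonneg_imp_has_sum summable_sums zero_le_power)
  then have "((\<lambda>n. p (int n) * real_of_int (int n) ^ j) has_sum a) UNIV"
    "((\<lambda>n. p (- int n) * real_of_int (- int n) ^ j) has_sum (- 1) ^ j * b) UNIV"
    using has_sum_cmult_right[of "\<lambda>n. real n ^ j * p (- int n)" UNIV b "(- 1) ^ j"]
    by (simp_all add: mult_ac power_minus[of "real _"])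
  from has_sum_int_split[OF this] show ?thesis by blast
qed

lemma log_concave_mean_bound:
  fixes p :: "int \<Rightarrow> real"
  assumes right: "log_concave_at_start (\<lambda>n. p (int n))"
    and left: "log_concave_at_start (\<lambda>n. p (- int n))"
    and mass: "(p has_sum 1) UNIV"
    and mean: "((\<lambda>k. p k * real_of_int k) has_sum \<mu>) UNIV"
  shows "\<bar>\<mu>\<bar> \<le> 1 / p 0 - 1"
proof -
  have nonneg: "0 \<le> p (int n)" "0 \<le> p (- int n)" for n
    using right left by (simp_all add: log_concave_at_start_def)
  obtain A B where A: "((\<lambda>n. p (int n)) has_sum A) UNIV" and B: "((\<lambda>n. p (- int n)) has_sum B) UNIV"
    and AB: "1 = A + B - p 0"
    using has_sum_int_halves[OF mass] by blast
  have "p 0 \<le> A" "p 0 \<le> B"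
    using start_le_has_sum[OF A] start_le_has_sum[OF B] nonneg by auto
  then have le1: "A \<le> 1" "B \<le> 1" using AB by auto
  obtain a b where "((\<lambda>n. p (int n) * real_of_int (int n)) has_sum a) UNIV"
    "((\<lambda>n. p (- int n) * real_of_int (- int n)) has_sum b) UNIV" and \<mu>: "\<mu> = a + b"
    using has_sum_int_halves[OF mean] by auto
  then have a: "((\<lambda>n. real n * p (int n)) has_sum a) UNIV"
    and b: "((\<lambda>n. real n * p (- int n)) has_sum - b) UNIV"
    by (simp_all add: mult_ac has_sum_uminus)
  have "0 \<le> a" "0 \<le> - b"
    by (rule has_sum_nonneg[OF a]; simp add: nonneg) (rule has_sum_nonneg[OF b]; simp add: nonneg)
  moreover have "a \<le> 1 / p 0 - 1" "- b \<le> 1 / p 0 - 1"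
    using first_moment_le_if_log_concave_at_start[OF right A le1(1) a]
      first_moment_le_if_log_concave_at_start[OF left B le1(2) b] by simp_all
  ultimately show ?thesis using \<mu> by linarith
qed

text \<open>Among the log-concave laws with given mass \<open>M = p 0\<close> at \<open>0\<close> and given mean \<open>\<mu>\<close>, the
two-sided geometric law has the largest second and fourth central moments. Its parameters solve \<open>R + S - 1 = 1 / M\<close> and \<open>R - S = \<mu>\<close>, and the
bound on the mean says precisely that the solutions are at least \<open>1\<close>, that is, that the ratios
are nonnegative.\<close>

lemma log_concave_moment_comparison:
  fixes p :: "int \<Rightarrow> real"
  assumes right: "log_concave_at_start (\<lambda>n. p (int n))"
    and left: "log_concave_at_start (\<lambda>n. p (- int n))"
    and mass: "(p has_sum 1) UNIV"
  obtains R S V C where "1 \<le> R" "1 \<le> S" "p 0 = 1 / (R + S - 1)"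
    "((\<lambda>k. p k * real_of_int k) has_sum R - S) UNIV"
    "((\<lambda>k. p k * (real_of_int k - (R - S)) ^ 2) has_sum V) UNIV"
    "((\<lambda>k. p k * (real_of_int k - (R - S)) ^ 4) has_sum C) UNIV"
    "V \<le> R * (R - 1) + S * (S - 1)"
    "C \<le> R * (R - 1) + S * (S - 1) + 9 * (R * (R - 1) + S * (S - 1))\<^sup>2
          - 12 * (R * (R - 1)) * (S * (S - 1))"
    "V = R * (R - 1) + S * (S - 1) \<or>
     C = R * (R - 1) + S * (S - 1) + 9 * (R * (R - 1) + S * (S - 1))\<^sup>2
          - 12 * (R * (R - 1)) * (S * (S - 1)) \<longrightarrow>
     p = two_sided_geometric (1 / (R + S - 1)) (1 - 1 / R) (1 - 1 / S)"
proof -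
  note moment = log_concave_moment_has_sum[OF right left mass]
  obtain \<mu> where mean: "((\<lambda>k. p k * real_of_int k) has_sum \<mu>) UNIV"
    using moment[of 1] by auto
  obtain e2 e3 e4 where "((\<lambda>k. p k * real_of_int k ^ 2) has_sum e2) UNIV"
    "((\<lambda>k. p k * real_of_int k ^ 3) has_sum e3) UNIV"
    "((\<lambda>k. p k * real_of_int k ^ 4) has_sum e4) UNIV"
    using moment by blast
  note central = has_sum_central_moments[OF mass mean this]
  define V where "V = e2 - \<mu> ^ 2"
  define C where "C = e4 - 4 * \<mu> * e3 + 6 * \<mu> ^ 2 * e2 - 3 * \<mu> ^ 4"
  have pos: "0 < p 0" using right by (simp add: log_concave_at_start_def)
  have bound: "\<bar>\<mu>\<bar> \<le> 1 / p 0 - 1"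
    by (rule log_concave_mean_bound[OF right left mass mean])
  define R S where "R = (1 / p 0 + 1 + \<mu>) / 2" and "S = (1 / p 0 + 1 - \<mu>) / 2"
  have R: "1 \<le> R" and S: "1 \<le> S" using bound by (auto simp: R_def S_def abs_le_iff)
  have \<mu>: "\<mu> = R - S" by (simp add: R_def S_def field_simps)
  have "R + S - 1 = 1 / p 0" by (simp add: R_def S_def field_simps)
  then have p0: "p 0 = 1 / (R + S - 1)" by simp
  define r s where "r = 1 - 1 / R" and "s = 1 - 1 / S"
  have rs: "0 \<le> r" "0 \<le> s" using R S by (auto simp: r_def s_def)
  let ?q = "two_sided_geometric (p 0) r s"
  let ?V = "R * (R - 1) + S * (S - 1)"
  let ?C = "?V + 9 * ?V\<^sup>2 - 12 * (R * (R - 1)) * (S * (S - 1))"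
  note q = two_sided_geometric_moments[OF R S, folded p0 r_def s_def \<mu>]
  define D where "D k = ?q k - p k" for k
  have D0: "(D has_sum 0) UNIV"
    using has_sum_diff[OF q(1) mass] by (simp add: D_def[abs_def])
  have D1: "((\<lambda>k. D k * real_of_int k) has_sum 0) UNIV"
    using has_sum_diff[OF q(2) mean] by (simp add: D_def algebra_simps)
  have D2: "((\<lambda>k. D k * (real_of_int k - \<mu>) ^ 2) has_sum ?V - V) UNIV"
    using has_sum_diff[OF q(3) central(1)] by (simp add: D_def V_def left_diff_distrib)
  have D4: "((\<lambda>k. D k * (real_of_int k - \<mu>) ^ 4) has_sum ?C - C) UNIV"
    using has_sum_diff[OF q(4) central(2)] by (simp add: D_def C_def left_diff_distrib)
  have "V \<le> ?V \<and> C \<le> ?C \<and> (V = ?V \<or> C = ?C \<longrightarrow> (\<forall>k. D k = 0))"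
  proof (cases rule: two_sided_geometric_crossings[OF right left rs, folded D_def, OF D0 D1])
    case 1
    then show ?thesis using has_sum_unique[OF D2, of 0] has_sum_unique[OF D4, of 0] by simp
  next
    case (2 a b)
    define h where "h k = (real_of_int k - \<mu>)\<^sup>2 + ((a - \<mu>) + (b - \<mu>)) * (real_of_int k - \<mu>)
      + ((a - \<mu>)\<^sup>2 + (a - \<mu>) * (b - \<mu>) + (b - \<mu>)\<^sup>2)" for k
    have h: "0 < h k" for k
      unfolding h_def by (rule quartic_chord_quotient_pos) (use 2 in auto)
    have chord2: "(real_of_int k - \<mu>) ^ 2 = (real_of_int k - a) * (real_of_int k - b) * 1
        + (a + b - 2 * \<mu>) * real_of_int k + (\<mu>\<^sup>2 - a * b)" for k
      by (simp add: power2_eq_square algebra_simps)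
    let ?l = "((a - \<mu>) + (b - \<mu>)) * ((a - \<mu>)\<^sup>2 + (b - \<mu>)\<^sup>2)"
    have chord4: "(real_of_int k - \<mu>) ^ 4 = (real_of_int k - a) * (real_of_int k - b) * h k
        + ?l * real_of_int k
        + (- ?l * \<mu> - (a - \<mu>) * (b - \<mu>) * ((a - \<mu>)\<^sup>2 + (a - \<mu>) * (b - \<mu>) + (b - \<mu>)\<^sup>2))" for k
    proof -
      define x y z where "x = real_of_int k - \<mu>" and "y = a - \<mu>" and "z = b - \<mu>"
      have "real_of_int k = x + \<mu>" "a = y + \<mu>" "b = z + \<mu>"
        by (auto simp: x_def y_def z_def)
      then show ?thesis
        unfolding h_def by (simp add: eval_nat_numeral algebra_simps)
    qed
    note cmp = two_crossings_comparison[OF D0 D1 2(4,2,3)]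
    note cmp2 = cmp[OF chord2 zero_less_one D2] and cmp4 = cmp[OF chord4 h D4]
    show ?thesis using cmp2 cmp4 by auto
  qed
  moreover have "p = ?q" if "\<forall>k. D k = 0"
    using that by (auto simp: D_def)
  ultimately show thesis
    using R S p0 mean central
    by (intro that[of R S V C, folded \<mu> p0 r_def s_def]) (auto simp: V_def C_def)
qed

text \<open>It remains to maximise over the mean. Write \<open>x\<close> for the variance \<open>v + w\<close> of the two-sided law and
\<open>W\<close> for that of the geometric law with the same mass \<open>M\<close> at its starting point.
Then \<open>W - x = 2 (R - 1) (S - 1) \<ge> 0\<close>, and
the fourth central moments are \<open>x + 9 x\<^sup>2 - 12 v w\<close> and \<open>W + 9 W\<^sup>2\<close>. The two inequalities of the
conclusion are \<open>V \<le> W\<close> and \<open>C \<le> W + 9 W\<^sup>2\<close>, written in terms of \<open>M = 1 / N\<close>. Equality in either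
of them forces both \<open>p\<close> to be two-sided geometric and \<open>R = 1\<close> or \<open>S = 1\<close>.\<close>

lemma log_concave_central_moment_bounds:
  fixes p :: "int \<Rightarrow> real"
  assumes right: "log_concave_at_start (\<lambda>n. p (int n))"
    and left: "log_concave_at_start (\<lambda>n. p (- int n))"
    and mass: "(p has_sum 1) UNIV"
  defines "M \<equiv> p 0"
  defines "one_sided \<equiv> p = two_sided_geometric M (1 - M) 0 \<or> p = two_sided_geometric M 0 (1 - M)"
  obtains \<mu> V C where
    "((\<lambda>k. p k * real_of_int k) has_sum \<mu>) UNIV"
    "((\<lambda>k. p k * (real_of_int k - \<mu>) ^ 2) has_sum V) UNIV"
    "((\<lambda>k. p k * (real_of_int k - \<mu>) ^ 4) has_sum C) UNIV"
    "M\<^sup>2 * V + M \<le> 1"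
    "M ^ 4 * C + M * (M\<^sup>2 - 10 * M + 18) \<le> 9"
    "M\<^sup>2 * V + M = 1 \<longleftrightarrow> one_sided"
    "M ^ 4 * C + M * (M\<^sup>2 - 10 * M + 18) = 9 \<longleftrightarrow> one_sided"
proof -
  obtain R S V C where R: "1 \<le> R" and S: "1 \<le> S" and p0: "p 0 = 1 / (R + S - 1)"
    and mean: "((\<lambda>k. p k * real_of_int k) has_sum R - S) UNIV"
    and V: "((\<lambda>k. p k * (real_of_int k - (R - S)) ^ 2) has_sum V) UNIV"
    and C: "((\<lambda>k. p k * (real_of_int k - (R - S)) ^ 4) has_sum C) UNIV"
    and V_le: "V \<le> R * (R - 1) + S * (S - 1)"
    and C_le: "C \<le> R * (R - 1) + S * (S - 1) + 9 * (R * (R - 1) + S * (S - 1))\<^sup>2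
          - 12 * (R * (R - 1)) * (S * (S - 1))"
    and eq: "V = R * (R - 1) + S * (S - 1) \<or>
     C = R * (R - 1) + S * (S - 1) + 9 * (R * (R - 1) + S * (S - 1))\<^sup>2
          - 12 * (R * (R - 1)) * (S * (S - 1)) \<longrightarrow>
     p = two_sided_geometric (1 / (R + S - 1)) (1 - 1 / R) (1 - 1 / S)"
    by (rule log_concave_moment_comparison[OF right left mass]) (rule that; assumption)
  define N where "N = R + S - 1"
  have N: "1 \<le> N" and M: "M = 1 / N" using R S by (auto simp: N_def M_def p0)
  define v w x where "v = R * (R - 1)" and "w = S * (S - 1)" and "x = v + w"
  define W where "W = N * (N - 1)"
  have v: "0 \<le> v" and w: "0 \<le> w" using R S by (auto simp: v_def w_def)
  have Wx: "W = x + 2 * ((R - 1) * (S - 1))"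
    by (simp add: W_def x_def v_def w_def N_def algebra_simps)
  have "0 \<le> (R - 1) * (S - 1)" using R S by simp
  then have xW: "x \<le> W" and x0: "0 \<le> x" using Wx v w by (auto simp: x_def)
  have C_le': "C \<le> x + 9 * x\<^sup>2 - 12 * v * w"
    using C_le by (simp add: v_def w_def x_def)
  have vw: "0 \<le> 12 * v * w" using v w by simp
  have sq: "x\<^sup>2 \<le> W\<^sup>2" using xW x0 by (intro power_mono) auto
  have a_form: "M\<^sup>2 * V + M = 1 + M\<^sup>2 * (V - W)"
    using N by (simp add: M W_def field_simps power2_eq_square)
  have b_form: "M ^ 4 * C + M * (M\<^sup>2 - 10 * M + 18) = 9 + M ^ 4 * (C - (W + 9 * W\<^sup>2))"
    using N by (simp add: M W_def field_simps eval_nat_numeral)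
  have one_sidedI: one_sided if "x = W" "V = x \<or> C = x + 9 * x\<^sup>2 - 12 * v * w"
  proof -
    have p: "p = two_sided_geometric (1 / (R + S - 1)) (1 - 1 / R) (1 - 1 / S)"
      using that(2) by (intro eq[rule_format]) (simp add: x_def v_def w_def)
    have "R = 1 \<or> S = 1" using that(1) Wx by simp
    then show ?thesis
      using p by (auto simp: one_sided_def M N_def)
  qed
  \<comment> \<open>The law determines its parameters, through its mean and its mass at \<open>0\<close>.\<close>
  have one_sidedD: "V = W \<and> C = W + 9 * W\<^sup>2" if one_sided
  proof -
    have exact: "V = W \<and> C = W + 9 * W\<^sup>2" if R': "1 \<le> R'" and S': "1 \<le> S'" and N': "R' + S' - 1 = N"
      and 1: "R' = 1 \<or> S' = 1"
      and p: "p = two_sided_geometric (1 / (R' + S' - 1)) (1 - 1 / R') (1 - 1 / S')" for R' S'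
    proof -
      note q = two_sided_geometric_moments[OF R' S', folded p]
      have "R - S = R' - S'" by (rule has_sum_unique[OF mean q(2)])
      with N' have "R' = R" "S' = S" by (auto simp: N_def)
      then show ?thesis
        using has_sum_unique[OF V] has_sum_unique[OF C] q(3,4) 1 by (auto simp: W_def N_def)
    qed
    from that show ?thesis
      using exact[of N 1] exact[of 1 N] N by (auto simp: one_sided_def M)
  qed
  show thesis
  proof (rule that[OF mean V C])
    have V': "V \<le> x" using V_le by (simp add: x_def v_def w_def)
    have CW: "C \<le> W + 9 * W\<^sup>2" using C_le' vw sq xW by linarith
    have Mpos: "0 < M" using N M by simp
    show "M\<^sup>2 * V + M \<le> 1"
      unfolding a_form using V' xW Mpos by (simp add: mult_le_0_iff)
    show "M ^ 4 * C + M * (M\<^sup>2 - 10 * M + 18) \<le> 9"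
      unfolding b_form using CW Mpos by (simp add: mult_le_0_iff)
    have "M\<^sup>2 * V + M = 1 \<longleftrightarrow> V = W" unfolding a_form using Mpos by simp
    also have "\<dots> \<longleftrightarrow> one_sided"
      using one_sidedI one_sidedD V' xW by auto
    finally show "M\<^sup>2 * V + M = 1 \<longleftrightarrow> one_sided" .
    have "M ^ 4 * C + M * (M\<^sup>2 - 10 * M + 18) = 9 \<longleftrightarrow> C = W + 9 * W\<^sup>2"
      unfolding b_form using Mpos by simp
    also have "\<dots> \<longleftrightarrow> one_sided"
    proof
      assume "C = W + 9 * W\<^sup>2"
      then have "x = W" "C = x + 9 * x\<^sup>2 - 12 * v * w"
        using C_le' vw sq xW by linarith+
      then show one_sided using one_sidedI by blast
    qed (use one_sidedD in blast)
    finally show "M ^ 4 * C + M * (M\<^sup>2 - 10 * M + 18) = 9 \<longleftrightarrow> one_sided" .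
  qed
qed

section \<open>Integer-valued random variables\<close>

lemma distr_eq_density:
  fixes X :: "'a \<Rightarrow> int"
  assumes "prob_space P" and X: "X \<in> measurable P (count_space UNIV)"
  shows "distr P (count_space UNIV) X = density (count_space UNIV) (\<lambda>k. ennreal \<P>(\<omega> in P. X \<omega> = k))"
proof (rule measure_eqI_countable[where A = UNIV])
  interpret prob_space P by fact
  fix k :: int
  have "emeasure (distr P (count_space UNIV) X) {k} = ennreal \<P>(\<omega> in P. X \<omega> = k)"
    using X by (subst emeasure_distr) (auto simp: emeasure_eq_measure intro!: arg_cong[where f = prob])
  then show "emeasure (distr P (count_space UNIV) X) {k} =
      emeasure (density (count_space UNIV) (\<lambda>k. ennreal \<P>(\<omega> in P. X \<omega> = k))) {k}"
    by (simp add: emeasure_density nn_integral_count_space_indicator[symmetric])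
qed auto

lemma expectation_int_valued:
  fixes X :: "'a \<Rightarrow> int" and f :: "int \<Rightarrow> real"
  assumes "prob_space P" and X: "X \<in> measurable P (count_space UNIV)"
  shows "integrable P (\<lambda>\<omega>. f (X \<omega>)) \<longleftrightarrow> (\<lambda>k. \<P>(\<omega> in P. X \<omega> = k) * f k) summable_on UNIV"
    and "prob_space.expectation P (\<lambda>\<omega>. f (X \<omega>)) = (\<Sum>\<^sub>\<infinity>k. \<P>(\<omega> in P. X \<omega> = k) * f k)"
proof -
  let ?g = "\<lambda>k. \<P>(\<omega> in P. X \<omega> = k) * f k"
  have abs: "Infinite_Set_Sum.abs_summable_on ?g UNIV \<longleftrightarrow> ?g summable_on UNIV"
    unfolding abs_summable_equivalent[symmetric] by (rule summable_on_iff_abs_summable_on_real[symmetric])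
  have "integrable P (\<lambda>\<omega>. f (X \<omega>)) \<longleftrightarrow> integrable (distr P (count_space UNIV) X) f"
    using X by (subst integrable_distr_eq) auto
  also have "\<dots> \<longleftrightarrow> integrable (count_space UNIV) ?g"
    unfolding distr_eq_density[OF assms] by (subst integrable_density) auto
  also have "\<dots> \<longleftrightarrow> ?g summable_on UNIV"
    unfolding abs[symmetric] by (simp add: abs_summable_on_def)
  finally show int: "integrable P (\<lambda>\<omega>. f (X \<omega>)) \<longleftrightarrow> ?g summable_on UNIV" .
  have "prob_space.expectation P (\<lambda>\<omega>. f (X \<omega>)) = integral\<^sup>L (distr P (count_space UNIV) X) f"
    using X by (subst integral_distr) auto
  also have "\<dots> = infsetsum ?g UNIV"
    unfolding distr_eq_density[OF assms] infsetsum_def by (subst integral_density) auto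
  also have "\<dots> = infsum ?g UNIV"
  proof (cases "?g summable_on UNIV")
    case True
    then show ?thesis
      unfolding abs[symmetric] by (intro infsetsum_infsum) (simp add: abs_summable_equivalent)
  next
    case False
    then show ?thesis
      by (simp add: infsum_not_exists not_summable_infsetsum_eq abs)
  qed
  finally show "prob_space.expectation P (\<lambda>\<omega>. f (X \<omega>)) = infsum ?g UNIV" .
qed

lemma law_eq_pmf_iff:
  fixes X :: "'a \<Rightarrow> int"
  assumes "prob_space P" and X: "X \<in> measurable P (count_space UNIV)"
  shows "distr P (count_space UNIV) X = measure_pmf N \<longleftrightarrow> (\<forall>k. \<P>(\<omega> in P. X \<omega> = k) = pmf N k)"
proof
  interpret prob_space P by fact
  assume "distr P (count_space UNIV) X = measure_pmf N"
  then have "measure (distr P (count_space UNIV) X) {k} = pmf N k" for k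
    by (simp add: pmf.rep_eq)
  moreover have "measure (distr P (count_space UNIV) X) {k} = \<P>(\<omega> in P. X \<omega> = k)" for k
    using X by (subst measure_distr) (auto intro!: arg_cong[where f = prob])
  ultimately show "\<forall>k. \<P>(\<omega> in P. X \<omega> = k) = pmf N k" by simp
next
  assume "\<forall>k. \<P>(\<omega> in P. X \<omega> = k) = pmf N k"
  then show "distr P (count_space UNIV) X = measure_pmf N"
    by (simp add: distr_eq_density[OF assms] measure_pmf_eq_density)
qed

lemma pmf_translated_geometric:
  assumes q: "0 \<le> q" "q < 1"
  shows "pmf (map_pmf (\<lambda>k. m + int k) (geometric_pmf (1 - q))) n = two_sided_geometric (1 - q) q 0 (n - m)"
    and "pmf (map_pmf (\<lambda>k. m - int k) (geometric_pmf (1 - q))) n = two_sided_geometric (1 - q) 0 q (n - m)"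
proof -
  have up: "inj (\<lambda>k. m + int k)" and down: "inj (\<lambda>k. m - int k)" by (auto simp: inj_on_def)
  show "pmf (map_pmf (\<lambda>k. m + int k) (geometric_pmf (1 - q))) n = two_sided_geometric (1 - q) q 0 (n - m)"
  proof (cases "m \<le> n")
    case True
    then show ?thesis
      using pmf_map_inj'[OF up, of "geometric_pmf (1 - q)" "nat (n - m)"] q
      by (simp add: two_sided_geometric_def)
  next
    case False
    then show ?thesis
      by (subst pmf_map_outside) (auto simp: two_sided_geometric_def power_0_left)
  qed
  show "pmf (map_pmf (\<lambda>k. m - int k) (geometric_pmf (1 - q))) n = two_sided_geometric (1 - q) 0 q (n - m)"
  proof (cases "n \<le> m")
    case True
    then show ?thesis
      using pmf_map_inj'[OF down, of "geometric_pmf (1 - q)" "nat (m - n)"] q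
      by (auto simp: two_sided_geometric_def)
  next
    case False
    then show ?thesis
      by (subst pmf_map_outside) (auto simp: two_sided_geometric_def power_0_left)
  qed
qed

text \<open>Identifies the translation in a geometric law: it has a single mode, so the starting point of the
geometric law is the point where the maximum is attained.\<close>

lemma one_sided_geometric_mode_unique:
  assumes q: "0 \<le> q" "q < 1"
    and "two_sided_geometric (1 - q) q 0 k \<ge> 1 - q \<or> two_sided_geometric (1 - q) 0 q k \<ge> 1 - q"
  shows "k = 0"
proof (rule ccontr)
  assume "k \<noteq> 0"
  have strict: "(1 - q) * t ^ n < 1 - q" if "t = q \<or> t = 0" "0 < n" for t and n :: nat
    using that q power_Suc_less_one[of q "n - 1"] by (cases "q = 0") (auto simp: power_0_left)
  show False
    using assms(3) \<open>k \<noteq> 0\<close> strict[of q "nat k"] strict[of 0 "nat k"]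
      strict[of q "nat (- k)"] strict[of 0 "nat (- k)"]
    by (auto simp: two_sided_geometric_def split: if_splits)
qed

lemma geometric_iff_one_sided_at_mode:
  fixes P :: "'a measure" and X :: "'a \<Rightarrow> int"
  assumes "prob_space P" and X: "X \<in> measurable P (count_space UNIV)"
    and mode: "\<And>n. \<P>(\<omega> in P. X \<omega> = n) \<le> \<P>(\<omega> in P. X \<omega> = m)"
    and pos: "0 < \<P>(\<omega> in P. X \<omega> = m)"
  defines "p \<equiv> \<lambda>k. \<P>(\<omega> in P. X \<omega> = m + k)" and "M \<equiv> \<P>(\<omega> in P. X \<omega> = m)"
  shows "geometric_up_to_translation_reflection P X \<longleftrightarrow>
    p = two_sided_geometric M (1 - M) 0 \<or> p = two_sided_geometric M 0 (1 - M)"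
proof -
  interpret prob_space P by fact
  have law: "distr P (count_space UNIV) X = measure_pmf (map_pmf (\<lambda>k. a + int k) (geometric_pmf (1 - q)))
      \<longleftrightarrow> (\<forall>n. \<P>(\<omega> in P. X \<omega> = n) = two_sided_geometric (1 - q) q 0 (n - a))"
    "distr P (count_space UNIV) X = measure_pmf (map_pmf (\<lambda>k. a - int k) (geometric_pmf (1 - q)))
      \<longleftrightarrow> (\<forall>n. \<P>(\<omega> in P. X \<omega> = n) = two_sided_geometric (1 - q) 0 q (n - a))"
    if "q \<in> {0..<1}" for q a
    using that by (simp_all add: law_eq_pmf_iff[OF assms(1) X] pmf_translated_geometric)
  have shift: "p = g \<longleftrightarrow> (\<forall>n. \<P>(\<omega> in P. X \<omega> = n) = g (n - m))" for g
  proof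
    show "\<forall>n. \<P>(\<omega> in P. X \<omega> = n) = g (n - m)" if "p = g"
      using that by (auto simp: p_def)
    show "p = g" if "\<forall>n. \<P>(\<omega> in P. X \<omega> = n) = g (n - m)"
      using that by (auto simp: p_def)
  qed
  show ?thesis
  proof
    assume "geometric_up_to_translation_reflection P X"
    then obtain q a where q: "q \<in> {0..<1}" and
      g: "(\<forall>n. \<P>(\<omega> in P. X \<omega> = n) = two_sided_geometric (1 - q) q 0 (n - a)) \<or>
          (\<forall>n. \<P>(\<omega> in P. X \<omega> = n) = two_sided_geometric (1 - q) 0 q (n - a))"
      unfolding geometric_up_to_translation_reflection_def using law by blast
    have "1 - q = \<P>(\<omega> in P. X \<omega> = a)" using g by auto
    then have "1 - q \<le> \<P>(\<omega> in P. X \<omega> = m)" using mode by simp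
    then have "m - a = 0"
      using g q by (intro one_sided_geometric_mode_unique[of q]) auto
    then have "a = m" "M = 1 - q" using g by (auto simp: M_def)
    then show "p = two_sided_geometric M (1 - M) 0 \<or> p = two_sided_geometric M 0 (1 - M)"
      using g by (simp add: shift)
  next
    assume "p = two_sided_geometric M (1 - M) 0 \<or> p = two_sided_geometric M 0 (1 - M)"
    moreover define q where "q = 1 - M"
    ultimately have "p = two_sided_geometric (1 - q) q 0 \<or> p = two_sided_geometric (1 - q) 0 q"
      by simp
    moreover have "q \<in> {0..<1}" using pos by (simp add: q_def M_def)
    ultimately show "geometric_up_to_translation_reflection P X"
      unfolding geometric_up_to_translation_reflection_def shift using law[of q m] by blast
  qed
qed

theorem theorem1p4:
  fixes P :: "'a measure" and X :: "'a \<Rightarrow> int"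
  assumes "prob_space P"
    and "X \<in> measurable P (count_space UNIV)"
    and "log_concave_rv P X"
  shows "let Y = (\<lambda>\<omega>. real_of_int (X \<omega>));
             M = max_prob P X;
             \<mu> = prob_space.expectation P Y;
             V = prob_space.variance P Y;
             C = prob_space.expectation P (\<lambda>\<omega>. \<bar>Y \<omega> - \<mu>\<bar> ^ 4)
         in integrable P Y \<and> integrable P (\<lambda>\<omega>. (Y \<omega> - \<mu>)\<^sup>2) \<and> integrable P (\<lambda>\<omega>. \<bar>Y \<omega> - \<mu>\<bar> ^ 4) \<and>
            M\<^sup>2 * V + M \<le> 1 \<and>
            M ^ 4 * C + M * (M\<^sup>2 - 10 * M + 18) \<le> 9 \<and>
            (M\<^sup>2 * V + M = 1 \<longleftrightarrow> geometric_up_to_translation_reflection P X) \<and>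
            (M ^ 4 * C + M * (M\<^sup>2 - 10 * M + 18) = 9 \<longleftrightarrow>
               geometric_up_to_translation_reflection P X)"
proof -
  interpret prob_space P by fact
  note X = assms(2)
  obtain m where m: "max_prob P X = \<P>(\<omega> in P. X \<omega> = m)"
    and mode: "\<And>n. \<P>(\<omega> in P. X \<omega> = n) \<le> \<P>(\<omega> in P. X \<omega> = m)"
    using max_prob_attained[OF assms(1,2)] by blast
  define p where "p k = \<P>(\<omega> in P. X \<omega> = m + k)" for k
  have "bij (\<lambda>k. m + k)"
    by (rule bij_betw_byWitness[where f' = "\<lambda>k. k - m"]) auto
  then have shift: "((\<lambda>k. p k * g (m + k)) has_sum s) UNIV \<longleftrightarrow>
      ((\<lambda>k. \<P>(\<omega> in P. X \<omega> = k) * g k) has_sum s) UNIV" for g s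
    unfolding p_def by (rule has_sum_reindex_bij_betw)
  have expect: "integrable P (\<lambda>\<omega>. g (X \<omega>)) \<and> expectation (\<lambda>\<omega>. g (X \<omega>)) = s"
    if "((\<lambda>k. p k * g (m + k)) has_sum s) UNIV" for g s
    using that[unfolded shift] expectation_int_valued[OF assms(1) X, of g]
    unfolding has_sum_iff by simp
  have mass: "(p has_sum 1) UNIV"
  proof -
    have "(\<lambda>k. \<P>(\<omega> in P. X \<omega> = k) * 1) summable_on UNIV"
      by (rule expectation_int_valued(1)[OF assms(1) X, THEN iffD1]) simp
    moreover have "(\<Sum>\<^sub>\<infinity>k. \<P>(\<omega> in P. X \<omega> = k) * 1) = 1"
      by (subst expectation_int_valued(2)[OF assms(1) X, symmetric]) (simp add: prob_space)
    ultimately show ?thesis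
      using shift[of "\<lambda>_. 1" 1] unfolding has_sum_iff by simp
  qed
  have pos: "0 < p 0"
  proof (rule ccontr)
    assume "\<not> 0 < p 0"
    then have "p k = 0" for k
      using mode[of "m + k"] by (intro antisym) (auto simp: p_def intro: order_trans)
    then have "p = (\<lambda>_. 0)" by auto
    then show False using mass has_sum_unique[OF mass, of 0] by simp
  qed
  obtain f where f: "log_concave_fun f" "\<And>n. \<P>(\<omega> in P. X \<omega> = n) = f (real_of_int n)"
    using assms(3) unfolding log_concave_rv_def by blast
  have fm: "0 < f (real_of_int m)" using pos f(2)[of m] by (simp add: p_def)
  have right: "log_concave_at_start (\<lambda>n. p (int n))" and left: "log_concave_at_start (\<lambda>n. p (- int n))"
    using log_concave_at_start_if_log_concave_fun[OF f(1) fm, of 1]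
      log_concave_at_start_if_log_concave_fun[OF f(1) fm, of "- 1"]
    by (simp_all add: p_def f(2))
  have M: "max_prob P X = p 0" by (simp add: m p_def)
  have geo: "geometric_up_to_translation_reflection P X \<longleftrightarrow>
      p = two_sided_geometric (p 0) (1 - p 0) 0 \<or> p = two_sided_geometric (p 0) 0 (1 - p 0)"
    using geometric_iff_one_sided_at_mode[OF assms(1) X mode] pos by (simp add: p_def[abs_def])
  obtain \<mu> V C where
    mean: "((\<lambda>k. p k * real_of_int k) has_sum \<mu>) UNIV"
    and V: "((\<lambda>k. p k * (real_of_int k - \<mu>) ^ 2) has_sum V) UNIV"
    and C: "((\<lambda>k. p k * (real_of_int k - \<mu>) ^ 4) has_sum C) UNIV"
    and bounds: "(p 0)\<^sup>2 * V + p 0 \<le> 1"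
      "p 0 ^ 4 * C + p 0 * ((p 0)\<^sup>2 - 10 * p 0 + 18) \<le> 9"
      "(p 0)\<^sup>2 * V + p 0 = 1 \<longleftrightarrow> geometric_up_to_translation_reflection P X"
      "p 0 ^ 4 * C + p 0 * ((p 0)\<^sup>2 - 10 * p 0 + 18) = 9 \<longleftrightarrow>
        geometric_up_to_translation_reflection P X"
    by (rule log_concave_central_moment_bounds[OF right left mass]) (rule that; simp add: geo)
  have "((\<lambda>k. p k * real_of_int k + real_of_int m * p k) has_sum (\<mu> + real_of_int m * 1)) UNIV"
    by (intro has_sum_add has_sum_cmult_right mean mass)
  then have "((\<lambda>k. p k * real_of_int (m + k)) has_sum (real_of_int m + \<mu>)) UNIV"
    by (simp add: algebra_simps)
  then have Y: "integrable P (\<lambda>\<omega>. real_of_int (X \<omega>))"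
    "expectation (\<lambda>\<omega>. real_of_int (X \<omega>)) = real_of_int m + \<mu>"
    using expect[of real_of_int] by auto
  have "((\<lambda>k. p k * (real_of_int (m + k) - (real_of_int m + \<mu>))\<^sup>2) has_sum V) UNIV"
    using V by simp
  then have Y2: "integrable P (\<lambda>\<omega>. (real_of_int (X \<omega>) - (real_of_int m + \<mu>))\<^sup>2)"
    "expectation (\<lambda>\<omega>. (real_of_int (X \<omega>) - (real_of_int m + \<mu>))\<^sup>2) = V"
    using expect[of "\<lambda>k. (real_of_int k - (real_of_int m + \<mu>))\<^sup>2"] by auto
  have "((\<lambda>k. p k * \<bar>real_of_int (m + k) - (real_of_int m + \<mu>)\<bar> ^ 4) has_sum C) UNIV"
    using C by simp
  then have Y4: "integrable P (\<lambda>\<omega>. \<bar>real_of_int (X \<omega>) - (real_of_int m + \<mu>)\<bar> ^ 4)"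
    "expectation (\<lambda>\<omega>. \<bar>real_of_int (X \<omega>) - (real_of_int m + \<mu>)\<bar> ^ 4) = C"
    using expect[of "\<lambda>k. \<bar>real_of_int k - (real_of_int m + \<mu>)\<bar> ^ 4"] by blast+
  show ?thesis
    unfolding Let_def M Y(2) Y2(2) Y4(2) using Y(1) Y2(1) Y4(1) bounds by blast
qed

end
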